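(* Let $a\ge0$ and let $k\ge1$ be an integer. Consider an open set $\Omega\subset\mathbb R^{k+1}_+$ and suppose that the function $u\in C^3(\Omega)$ is a solution in $\Omega$ of the equation $$L_a u=-1 .$$ Then the function $$P_a:=\Gamma^{L_a}(u)+\frac{2}{a+1+k}\,u$$ satisfies in $\Omega$ the differential inequality $$L_aP_a\ge 0 .$$ Finally, for a solution of $L_au=-1$, equality is true in $L_aP_a\ge0$ if and only if there exist $y_0\in\mathbb R^k$ and $\gamma\in\mathbb R$ such that for any $(r,y)\in\Omega$ $$u(r,y)=\gamma-\frac{r^2+|y-y_0|^2}{2(a+1+k)} .$$
   Context: $\mathbb R^{k+1}_+=\{(r,y): r>0,\ y\in\mathbb R^k\}$. The Weinstein operator is $L_a u=\partial_{rr}u+\frac ar\partial_r u+\Delta_y u$, with $\Delta_y$ the Laplacian in $y\in\mathbb R^k$. The carré du champ of $L_a$ is $\Gamma^{L_a}(u)=\Gamma^{L_a}(u,u)$ with $\Gamma^{L_a}(u,v)=\frac12[L_a(uv)-uL_av-vL_au]$; explicitly $\Gamma^{L_a}(u)=(\partial_ru)^2+|\nabla_yu|^2$.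
   Formalization: The "only if" part of the equality case is proved only for a > 0 and connected Ω, since it fails for a = 0 (paraboloids shifted in r) and for disconnected Ω (different γ on different components); the inequality and the "if" part hold for all a ≥ 0 and open Ω. *)

theory Defs
  imports "HOL-Analysis.Analysis"
begin

text \<open>Points of the half-space are pairs \<open>(r, y)\<close> with \<open>r > 0\<close> and \<open>y \<in> \<real>\<^sup>k\<close>,
  where \<open>k = CARD('k) \<ge> 1\<close>.\<close>

definition half_space :: "(real \<times> (real ^ 'k)) set" where
  "half_space = {(r, y). r > 0}"

definition partial_deriv :: "'a::real_normed_vector \<Rightarrow> ('a \<Rightarrow> real) \<Rightarrow> 'a \<Rightarrow> real" where
  "partial_deriv v f x = deriv (\<lambda>t. f (x + t *\<^sub>R v)) 0"

text \<open>Meant for open \<open>S\<close>, where it is the usual class \<open>C\<^sup>n(S)\<close>; the values of the function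
  outside \<open>S\<close> then play no role.\<close>

fun Cn_on :: "nat \<Rightarrow> 'a::euclidean_space set \<Rightarrow> ('a \<Rightarrow> real) \<Rightarrow> bool" where
  "Cn_on 0 S f \<longleftrightarrow> continuous_on S f"
| "Cn_on (Suc n) S f \<longleftrightarrow>
     (\<forall>x\<in>S. f differentiable (at x)) \<and> (\<forall>b\<in>Basis. Cn_on n S (partial_deriv b f))"

definition d_r :: "(real \<times> (real ^ 'k) \<Rightarrow> real) \<Rightarrow> real \<times> (real ^ 'k) \<Rightarrow> real" where
  "d_r = partial_deriv (1, 0)"

definition d_y :: "'k \<Rightarrow> (real \<times> (real ^ 'k) \<Rightarrow> real) \<Rightarrow> real \<times> (real ^ 'k) \<Rightarrow> real" where
  "d_y i = partial_deriv (0, axis i 1)"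

definition laplacian_y :: "(real \<times> (real ^ 'k) \<Rightarrow> real) \<Rightarrow> real \<times> (real ^ 'k) \<Rightarrow> real" where
  "laplacian_y u x = (\<Sum>i\<in>UNIV. d_y i (d_y i u) x)"

definition weinstein ::
  "real \<Rightarrow> (real \<times> (real ^ 'k) \<Rightarrow> real) \<Rightarrow> real \<times> (real ^ 'k) \<Rightarrow> real" where
  "weinstein a u x = d_r (d_r u) x + a / fst x * d_r u x + laplacian_y u x"

definition carre_du_champ ::
  "real \<Rightarrow> (real \<times> (real ^ 'k) \<Rightarrow> real) \<Rightarrow> (real \<times> (real ^ 'k) \<Rightarrow> real) \<Rightarrow>
   real \<times> (real ^ 'k) \<Rightarrow> real" where
  "carre_du_champ a u v x =
     1 / 2 * (weinstein a (\<lambda>z. u z * v z) x - u x * weinstein a v x - v x * weinstein a u x)"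

definition P_fun ::
  "real \<Rightarrow> (real \<times> (real ^ 'k) \<Rightarrow> real) \<Rightarrow> real \<times> (real ^ 'k) \<Rightarrow> real" where
  "P_fun a u x = carre_du_champ a u u x + 2 / (a + 1 + real CARD('k)) * u x"

end

theory Submission
  imports Defs
begin

text \<open>A Bochner identity. With \<open>N = a + 1 + k\<close> and \<open>w = u + (r\<^sup>2 + |y|\<^sup>2) / (2 N)\<close>, differentiating
  \<open>L\<^sub>a u = -1\<close> and commuting derivatives turns \<open>L\<^sub>a P\<^sub>a\<close> into the sum of squares
  \<open>2 (|D\<^sup>2 w|\<^sup>2 + a (\<partial>\<^sub>r w / r)\<^sup>2)\<close>. It vanishes identically only if \<open>D\<^sup>2 w = 0\<close> and, for \<open>a > 0\<close>,
  \<open>\<partial>\<^sub>r w = 0\<close>; on a connected set \<open>w\<close> is then an affine function of \<open>y\<close>, and completing the square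
  gives the paraboloid.\<close>

section \<open>Partial derivatives\<close>

text \<open>The parameter \<open>s\<close> is left free because the mean value theorem below needs
  the derivative along a whole segment, not only at \<open>s = 0\<close>.\<close>

lemma partial_deriv_line:
  assumes "(f has_derivative f') (at (x + s *\<^sub>R v))"
  shows "((\<lambda>t. f (x + t *\<^sub>R v)) has_real_derivative f' v) (at s)"
proof -
  have "((\<lambda>t. f (x + t *\<^sub>R v)) has_derivative (\<lambda>t. f' (t *\<^sub>R v))) (at s)"
    by (rule has_derivative_compose[where f = "\<lambda>t. x + t *\<^sub>R v" and g = f])
      (auto intro!: derivative_eq_intros assms)
  moreover have "(\<lambda>t. f' (t *\<^sub>R v)) = (*) (f' v)"
    using linear_scale[OF has_derivative_linear[OF assms]] by (auto simp: fun_eq_iff)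
  ultimately show ?thesis
    by (simp add: has_field_derivative_def)
qed

lemma partial_deriv_eq:
  assumes "(f has_derivative f') (at x)"
  shows "partial_deriv v f x = f' v"
  unfolding partial_deriv_def
  by (rule DERIV_imp_deriv) (use partial_deriv_line[of f f' x 0 v] assms in simp)

text \<open>\<open>partial_deriv\<close> accepts arbitrary directions, so at a point of
  differentiability it is the total derivative itself, linear in \<open>v\<close>; the calculus
  rules below are thus instances of the Frechet ones.\<close>

lemma has_derivative_partial_deriv:
  assumes "f differentiable at x"
  shows "(f has_derivative (\<lambda>v. partial_deriv v f x)) (at x)"
proof -
  obtain f' where f': "(f has_derivative f') (at x)"
    using assms by (auto simp: differentiable_def)
  then show ?thesis
    using partial_deriv_eq[OF f'] by simp
qed

text \<open>The derivative is taken at \<open>t = 0\<close>, and \<open>x + t v\<close> stays in the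
  open set for small \<open>t\<close>. Identities valid only on \<open>S\<close> can therefore be
  differentiated.\<close>

lemma partial_deriv_cong:
  assumes S: "open S" "x \<in> S" and eq: "\<And>z. z \<in> S \<Longrightarrow> f z = g z"
  shows "partial_deriv v f x = partial_deriv v g x"
  unfolding partial_deriv_def
proof (rule deriv_cong_ev)
  have "((\<lambda>t. x + t *\<^sub>R v) \<longlongrightarrow> x + 0 *\<^sub>R v) (nhds 0)"
    by (intro tendsto_intros filterlim_ident)
  then have "\<forall>\<^sub>F t in nhds 0. x + t *\<^sub>R v \<in> S"
    using S by (auto dest: topological_tendstoD)
  then show "\<forall>\<^sub>F t in nhds 0. f (x + t *\<^sub>R v) = g (x + t *\<^sub>R v)"
    by eventually_elim (rule eq)
qed simp

text \<open>The formulas for first partials of sums and products hold only on \<open>S\<close>; this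
  carries differentiability across them.\<close>

lemma differentiable_cong_open:
  assumes "open S" "x \<in> S" "\<And>z. z \<in> S \<Longrightarrow> f z = g z" "g differentiable at x"
  shows "f differentiable at x"
  using assms has_derivative_transform_within_open[of g _ x UNIV S f]
  unfolding differentiable_def by fastforce

lemma partial_deriv_mult:
  assumes "f differentiable at x" "g differentiable at x"
  shows "partial_deriv v (\<lambda>z. f z * g z) x
    = partial_deriv v f x * g x + f x * partial_deriv v g x"
  by (rule partial_deriv_eq)
    (auto intro!: derivative_eq_intros has_derivative_partial_deriv assms)

lemma partial_deriv_add:
  assumes "f differentiable at x" "g differentiable at x"
  shows "partial_deriv v (\<lambda>z. f z + g z) x = partial_deriv v f x + partial_deriv v g x"
  by (rule partial_deriv_eq)
    (auto intro!: derivative_eq_intros has_derivative_partial_deriv assms)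

lemma partial_deriv_cmult:
  assumes "f differentiable at x"
  shows "partial_deriv v (\<lambda>z. c * f z) x = c * partial_deriv v f x"
  by (rule partial_deriv_eq)
    (auto intro!: derivative_eq_intros has_derivative_partial_deriv assms)

lemma partial_deriv_sum:
  assumes "\<And>i. i \<in> I \<Longrightarrow> F i differentiable at x"
  shows "partial_deriv v (\<lambda>z. \<Sum>i\<in>I. F i z) x = (\<Sum>i\<in>I. partial_deriv v (F i) x)"
  by (rule partial_deriv_eq)
    (auto intro!: derivative_eq_intros has_derivative_partial_deriv assms)

text \<open>Young's form of the symmetry of second derivatives: one-point differentiability of the first
  partial derivatives suffices, so their continuity need not be tracked.\<close>

lemma second_difference_tendsto:
  fixes f :: "'a::real_normed_vector \<Rightarrow> real"
  assumes S: "open S" "x \<in> S" and f: "\<And>z. z \<in> S \<Longrightarrow> f differentiable at z"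
    and g: "partial_deriv v f differentiable at x"
  shows "((\<lambda>h. (f (x + h *\<^sub>R v + h *\<^sub>R w) - f (x + h *\<^sub>R v) - f (x + h *\<^sub>R w) + f x) / h\<^sup>2)
    \<longlongrightarrow> partial_deriv w (partial_deriv v f) x) (at_right 0)"
    (is "(?D \<longlongrightarrow> ?l) _")
proof (rule tendstoI)
  fix e :: real assume "e > 0"
  \<comment> \<open>The two remainder bounds below add up to
    \<open>\<epsilon> * (2 * norm v + norm w)\<close>. The extra 1 keeps \<open>K\<close> positive
    when both vectors vanish, and \<open>\<epsilon> = e / (2 * K)\<close> leaves a total of
    \<open>e / 2\<close>.\<close>
  define K where "K = 2 * norm v + norm w + 1"
  have K: "K > 0" unfolding K_def by (simp add: add_nonneg_pos)
  define \<epsilon> where "\<epsilon> = e / (2 * K)"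
  have \<epsilon>: "\<epsilon> > 0" using \<open>e > 0\<close> K by (simp add: \<epsilon>_def)
  let ?g = "partial_deriv v f"
  let ?A = "\<lambda>k. partial_deriv k ?g x"
  have A: "(?g has_derivative ?A) (at x)"
    using g by (rule has_derivative_partial_deriv)
  then have lin: "linear ?A"
    by (rule has_derivative_linear)
  obtain d1 where d1: "d1 > 0"
    "\<And>y. norm (y - x) < d1 \<Longrightarrow> norm (?g y - ?g x - ?A (y - x)) \<le> \<epsilon> * norm (y - x)"
    using A \<epsilon> unfolding has_derivative_at_alt by blast
  obtain d2 where d2: "d2 > 0" "ball x d2 \<subseteq> S"
    using S by (auto simp: open_contains_ball)
  \<comment> \<open>For \<open>h < d\<close> the parallelogram spanned by \<open>h v\<close> and
    \<open>h w\<close> at \<open>x\<close> lies both in \<open>S\<close> and where the first-order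
    expansion of \<open>?g\<close> is accurate.\<close>
  define d where "d = min d1 d2 / K"
  have "d > 0" using d1 d2 K by (simp add: d_def)
  have "dist (?D h) ?l < e" if h: "0 < h" "h < d" for h
  proof -
    have hK: "h * K < d1" "h * K < d2"
      using h K by (auto simp: d_def field_simps)
    have small: "norm (s *\<^sub>R v + t *\<^sub>R w) \<le> h * (norm v + norm w)"
      if "0 \<le> s" "s \<le> h" "0 \<le> t" "t \<le> h" for s t
    proof -
      have "norm (s *\<^sub>R v + t *\<^sub>R w) \<le> s * norm v + t * norm w"
        using norm_triangle_ineq[of "s *\<^sub>R v" "t *\<^sub>R w"] that by simp
      also have "\<dots> \<le> h * norm v + h * norm w"
        using that by (intro add_mono mult_right_mono) auto
      finally show ?thesis by (simp add: algebra_simps)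
    qed
    have lt: "h * (norm v + norm w) < h * K"
      using h by (auto simp: K_def intro!: mult_strict_left_mono add_nonneg_pos)
    have inS: "x + s *\<^sub>R v + t *\<^sub>R w \<in> S"
      if "0 \<le> s" "s \<le> h" "0 \<le> t" "t \<le> h" for s t
    proof -
      have "dist x (x + k) = norm k" for k
        by (simp add: dist_norm)
      then have "x + s *\<^sub>R v + t *\<^sub>R w \<in> ball x d2"
        using small[OF that] lt hK by (simp add: add.assoc)
      then show ?thesis using d2 by blast
    qed
    \<comment> \<open>The second difference is \<open>?\<phi> h - ?\<phi> 0\<close>, so one use of
      the mean value theorem replaces \<open>f\<close> by its derivative \<open>?g\<close>.\<close>
    let ?\<phi> = "\<lambda>s. f ((x + h *\<^sub>R w) + s *\<^sub>R v) - f (x + s *\<^sub>R v)"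
    have der: "(?\<phi> has_real_derivative (?g ((x + h *\<^sub>R w) + s *\<^sub>R v) - ?g (x + s *\<^sub>R v))) (at s)"
      if "0 \<le> s" "s \<le> h" for s
      using inS[of s h] inS[of s 0] that h
      by (intro DERIV_diff partial_deriv_line has_derivative_partial_deriv f)
        (auto simp: algebra_simps)
    obtain z where z: "0 < z" "z < h"
      "?\<phi> h - ?\<phi> 0 = (h - 0) * (?g ((x + h *\<^sub>R w) + z *\<^sub>R v) - ?g (x + z *\<^sub>R v))"
      using MVT2[OF h(1) der] by blast
    let ?R = "\<lambda>k. ?g (x + k) - ?g x - ?A k"
    have R: "\<bar>?R (z *\<^sub>R v + t *\<^sub>R w)\<bar> \<le> \<epsilon> * (h * (norm v + norm w))"
      if "0 \<le> t" "t \<le> h" for t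
    proof -
      have "norm (z *\<^sub>R v + t *\<^sub>R w) \<le> h * (norm v + norm w)"
        using small[of z t] z that by simp
      moreover have "\<bar>?R (z *\<^sub>R v + t *\<^sub>R w)\<bar> \<le> \<epsilon> * norm (z *\<^sub>R v + t *\<^sub>R w)"
        using d1(2)[of "x + (z *\<^sub>R v + t *\<^sub>R w)"] calculation lt hK by simp
      ultimately show ?thesis
        using \<epsilon> by (meson mult_left_mono less_imp_le order_trans)
    qed
    have R0: "\<bar>?R (z *\<^sub>R v)\<bar> \<le> \<epsilon> * (h * norm v)"
    proof -
      have *: "norm (z *\<^sub>R v) \<le> h * norm v"
        using z by (simp add: mult_right_mono)
      also have "\<dots> \<le> h * (norm v + norm w)"
        using h by simp
      finally have "norm (z *\<^sub>R v) < d1"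
        using lt hK by linarith
      then have "\<bar>?R (z *\<^sub>R v)\<bar> \<le> \<epsilon> * norm (z *\<^sub>R v)"
        using d1(2)[of "x + z *\<^sub>R v"] by simp
      with * show ?thesis
        using \<epsilon> by (meson mult_left_mono less_imp_le order_trans)
    qed
    have "?D h = (?\<phi> h - ?\<phi> 0) / h\<^sup>2"
      by (simp add: algebra_simps)
    also have "\<dots> = (?g (x + (z *\<^sub>R v + h *\<^sub>R w)) - ?g (x + z *\<^sub>R v)) / h"
      unfolding z(3) using h by (simp add: power2_eq_square add_ac)
    \<comment> \<open>The linear parts differ by \<open>?A (h w) = h * ?l\<close>, so the unknown
      \<open>z\<close> survives only in the remainders.\<close>
    also have "\<dots> = (?R (z *\<^sub>R v + h *\<^sub>R w) - ?R (z *\<^sub>R v)) / h + ?l"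
      using h by (simp add: linear_add[OF lin] linear_scale[OF lin] field_simps)
    finally have "\<bar>?D h - ?l\<bar> = \<bar>?R (z *\<^sub>R v + h *\<^sub>R w) - ?R (z *\<^sub>R v)\<bar> / h"
      using h by (simp add: abs_divide)
    also have "\<dots> \<le> (\<epsilon> * (h * (norm v + norm w)) + \<epsilon> * (h * norm v)) / h"
      using R[of h] R0 h by (intro divide_right_mono) linarith+
    also have "\<dots> = \<epsilon> * (2 * norm v + norm w)"
      using h by (simp add: field_simps)
    also have "\<dots> \<le> \<epsilon> * K"
      using \<epsilon> by (simp add: K_def)
    also have "\<dots> < e"
      using K \<open>e > 0\<close> by (simp add: \<epsilon>_def)
    finally show ?thesis
      by (simp add: dist_real_def)
  qed
  then show "\<forall>\<^sub>F h in at_right 0. dist (?D h) ?l < e"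
    using \<open>d > 0\<close> by (auto simp: eventually_at_right_field)
qed

text \<open>The second difference quotient is symmetric in \<open>v\<close> and \<open>w\<close>, so
  both mixed derivatives are limits of the same expression.\<close>

lemma partial_deriv_commute:
  fixes f :: "'a::real_normed_vector \<Rightarrow> real"
  assumes S: "open S" "x \<in> S" and f: "\<And>z. z \<in> S \<Longrightarrow> f differentiable at z"
    and v: "partial_deriv v f differentiable at x" and w: "partial_deriv w f differentiable at x"
  shows "partial_deriv v (partial_deriv w f) x = partial_deriv w (partial_deriv v f) x"
proof (rule tendsto_unique[OF trivial_limit_at_right_real])
  show "((\<lambda>h. (f (x + h *\<^sub>R v + h *\<^sub>R w) - f (x + h *\<^sub>R v) - f (x + h *\<^sub>R w) + f x) / h\<^sup>2)
    \<longlongrightarrow> partial_deriv w (partial_deriv v f) x) (at_right 0)"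
    using S f v by (rule second_difference_tendsto)
  show "((\<lambda>h. (f (x + h *\<^sub>R v + h *\<^sub>R w) - f (x + h *\<^sub>R v) - f (x + h *\<^sub>R w) + f x) / h\<^sup>2)
    \<longlongrightarrow> partial_deriv v (partial_deriv w f) x) (at_right 0)"
    using second_difference_tendsto[OF S f w, of v] by (simp add: algebra_simps)
qed

text \<open>A linear map that vanishes on a basis is zero, so the total derivative vanishes on the
  connected set.\<close>

lemma partial_derivs_zero_imp_constant:
  fixes f :: "'a::euclidean_space \<Rightarrow> real"
  assumes "open S" "connected S" and f: "\<And>z. z \<in> S \<Longrightarrow> f differentiable at z"
    and 0: "\<And>z b. z \<in> S \<Longrightarrow> b \<in> Basis \<Longrightarrow> partial_deriv b f z = 0"
    and "x \<in> S" "y \<in> S"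
  shows "f x = f y"
proof (rule has_derivative_zero_unique_connected[OF assms(1,2) _ assms(5,6)])
  fix z assume z: "z \<in> S"
  let ?A = "\<lambda>v. partial_deriv v f z"
  have der: "(f has_derivative ?A) (at z)"
    by (rule has_derivative_partial_deriv[OF f[OF z]])
  have "?A = (\<lambda>v. 0)"
    using linear_eq_stdbasis[OF has_derivative_linear[OF der] linear_zero] 0[OF z] by auto
  with der show "(f has_derivative (\<lambda>v. 0)) (at z)" by simp
qed

section \<open>Second-order calculus on an open set\<close>

definition twice_differentiable_on :: "('a::euclidean_space \<Rightarrow> real) \<Rightarrow> 'a set \<Rightarrow> bool" where
  "twice_differentiable_on f S \<longleftrightarrow>
     (\<forall>x\<in>S. f differentiable at x \<and> (\<forall>b\<in>Basis. partial_deriv b f differentiable at x))"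

lemma twice_differentiable_onD:
  assumes "twice_differentiable_on f S" "x \<in> S"
  shows "f differentiable at x" "b \<in> Basis \<Longrightarrow> partial_deriv b f differentiable at x"
  using assms by (auto simp: twice_differentiable_on_def)

lemma twice_differentiable_on_Cn_on:
  "Cn_on (Suc (Suc n)) S f \<Longrightarrow> twice_differentiable_on f S"
  by (auto simp: twice_differentiable_on_def)

lemma twice_differentiable_on_mult:
  assumes "open S" and f: "twice_differentiable_on f S" and g: "twice_differentiable_on g S"
  shows "twice_differentiable_on (\<lambda>z. f z * g z) S"
  unfolding twice_differentiable_on_def
proof (intro ballI conjI)
  fix x assume x: "x \<in> S"
  note D = twice_differentiable_onD[OF f] twice_differentiable_onD[OF g]
  show "(\<lambda>z. f z * g z) differentiable at x"
    using D x by (intro differentiable_mult)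
  fix b :: 'a assume b: "b \<in> Basis"
  show "partial_deriv b (\<lambda>z. f z * g z) differentiable at x"
    by (rule differentiable_cong_open[OF \<open>open S\<close> x partial_deriv_mult])
      (use D x b in \<open>auto intro!: differentiable_add differentiable_mult\<close>)
qed

lemma twice_differentiable_on_sum:
  assumes "open S" "finite I" and F: "\<And>i. i \<in> I \<Longrightarrow> twice_differentiable_on (F i) S"
  shows "twice_differentiable_on (\<lambda>z. \<Sum>i\<in>I. F i z) S"
  unfolding twice_differentiable_on_def
proof (intro ballI conjI)
  fix x assume x: "x \<in> S"
  note D = twice_differentiable_onD[OF F]
  show "(\<lambda>z. \<Sum>i\<in>I. F i z) differentiable at x"
    using D x \<open>finite I\<close> by (intro differentiable_sum) auto
  fix b :: 'a assume b: "b \<in> Basis"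
  show "partial_deriv b (\<lambda>z. \<Sum>i\<in>I. F i z) differentiable at x"
    by (rule differentiable_cong_open[OF \<open>open S\<close> x partial_deriv_sum])
      (use D x b \<open>finite I\<close> in \<open>auto intro!: differentiable_sum\<close>)
qed

lemma twice_differentiable_on_cmult:
  assumes "open S" and f: "twice_differentiable_on f S"
  shows "twice_differentiable_on (\<lambda>z. c * f z) S"
  unfolding twice_differentiable_on_def
proof (intro ballI conjI)
  fix x assume x: "x \<in> S"
  note D = twice_differentiable_onD[OF f]
  show "(\<lambda>z. c * f z) differentiable at x"
    using D x by (intro differentiable_mult) auto
  fix b :: 'a assume b: "b \<in> Basis"
  show "partial_deriv b (\<lambda>z. c * f z) differentiable at x"
    by (rule differentiable_cong_open[OF \<open>open S\<close> x partial_deriv_cmult])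
      (use D x b in \<open>auto intro!: differentiable_mult\<close>)
qed

lemma partial_deriv2_square:
  assumes "open S" and f: "twice_differentiable_on f S" and x: "x \<in> S" and b: "b \<in> Basis"
  shows "partial_deriv b (partial_deriv b (\<lambda>z. f z * f z)) x
    = 2 * f x * partial_deriv b (partial_deriv b f) x + 2 * (partial_deriv b f x)\<^sup>2"
proof -
  note D = twice_differentiable_onD[OF f]
  have "partial_deriv b (partial_deriv b (\<lambda>z. f z * f z)) x
    = partial_deriv b (\<lambda>z. 2 * (f z * partial_deriv b f z)) x"
    using D by (intro partial_deriv_cong[OF \<open>open S\<close> x]) (simp add: partial_deriv_mult)
  also have "\<dots> = 2 * partial_deriv b (\<lambda>z. f z * partial_deriv b f z) x"
    using D x b by (intro partial_deriv_cmult) (auto intro!: differentiable_mult)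
  also have "\<dots> = 2 * f x * partial_deriv b (partial_deriv b f) x + 2 * (partial_deriv b f x)\<^sup>2"
    using D x b by (simp add: partial_deriv_mult power2_eq_square algebra_simps)
  finally show ?thesis .
qed

section \<open>The Weinstein operator\<close>

lemma Basis_half_space:
  "(Basis :: (real \<times> (real ^ 'k)) set) = insert (1, 0) (range (\<lambda>i. (0, axis i 1)))"
  by (auto simp: Basis_prod_def Basis_vec_def)

lemma e_r_in_Basis: "(1, 0) \<in> (Basis :: (real \<times> (real ^ 'k)) set)"
  by (simp add: Basis_half_space)

text \<open>Treats \<open>r\<close> and \<open>y\<close> alike: the full Laplacian in 1 + k
  variables plus a first-order term. The Hessian can then be summed over \<open>Basis\<close>
  without splitting coordinates.\<close>

lemma weinstein_Basis:
  fixes u :: "real \<times> (real ^ 'k) \<Rightarrow> real"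
  shows "weinstein a u x
    = (\<Sum>b\<in>Basis. partial_deriv b (partial_deriv b u) x) + a / fst x * partial_deriv (1, 0) u x"
proof -
  have inj: "inj (\<lambda>i::'k. (0::real, axis i (1::real)))"
    by (auto simp: inj_def axis_eq_axis)
  have "(\<Sum>b\<in>Basis. partial_deriv b (partial_deriv b u) x) =
    partial_deriv (1, 0) (partial_deriv (1, 0) u) x
    + (\<Sum>b\<in>range (\<lambda>i. (0, axis i 1)). partial_deriv b (partial_deriv b u) x)"
    unfolding Basis_half_space by (subst sum.insert) auto
  then show ?thesis
    by (simp add: sum.reindex[OF inj] weinstein_def laplacian_y_def d_r_def d_y_def)
qed

lemma weinstein_cong:
  assumes S: "open S" "x \<in> S" and eq: "\<And>z. z \<in> S \<Longrightarrow> f z = g z"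
  shows "weinstein a f x = weinstein a g x"
proof -
  have 1: "partial_deriv b f z = partial_deriv b g z" if "z \<in> S" for b z
    using that eq by (intro partial_deriv_cong[OF S(1)])
  have "partial_deriv b (partial_deriv b f) x = partial_deriv b (partial_deriv b g) x" for b
    using 1 by (intro partial_deriv_cong[OF S])
  with 1[OF S(2)] show ?thesis
    by (simp add: weinstein_Basis)
qed

lemma weinstein_add:
  assumes "open S" "x \<in> S" and f: "twice_differentiable_on f S" and g: "twice_differentiable_on g S"
  shows "weinstein a (\<lambda>z. f z + g z) x = weinstein a f x + weinstein a g x"
proof -
  note D = twice_differentiable_onD[OF f] twice_differentiable_onD[OF g]
  have "partial_deriv b (partial_deriv b (\<lambda>z. f z + g z)) x
    = partial_deriv b (partial_deriv b f) x + partial_deriv b (partial_deriv b g) x"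
    if "b \<in> Basis" for b
  proof -
    have "partial_deriv b (partial_deriv b (\<lambda>z. f z + g z)) x
      = partial_deriv b (\<lambda>z. partial_deriv b f z + partial_deriv b g z) x"
      using D by (intro partial_deriv_cong[OF assms(1,2)] partial_deriv_add)
    then show ?thesis
      using D assms(2) that by (simp add: partial_deriv_add)
  qed
  then show ?thesis
    using D assms(2) by (simp add: weinstein_Basis partial_deriv_add sum.distrib algebra_simps)
qed

lemma weinstein_cmult:
  assumes "open S" "x \<in> S" and f: "twice_differentiable_on f S"
  shows "weinstein a (\<lambda>z. c * f z) x = c * weinstein a f x"
proof -
  note D = twice_differentiable_onD[OF f]
  have "partial_deriv b (partial_deriv b (\<lambda>z. c * f z)) x = c * partial_deriv b (partial_deriv b f) x"
    if "b \<in> Basis" for b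
  proof -
    have "partial_deriv b (partial_deriv b (\<lambda>z. c * f z)) x
      = partial_deriv b (\<lambda>z. c * partial_deriv b f z) x"
      using D by (intro partial_deriv_cong[OF assms(1,2)] partial_deriv_cmult)
    then show ?thesis
      using D assms(2) that by (simp add: partial_deriv_cmult)
  qed
  then show ?thesis
    using D assms(2) by (simp add: weinstein_Basis partial_deriv_cmult sum_distrib_left algebra_simps)
qed

lemma weinstein_sum:
  assumes "open S" "x \<in> S" "finite I" and F: "\<And>i. i \<in> I \<Longrightarrow> twice_differentiable_on (F i) S"
  shows "weinstein a (\<lambda>z. \<Sum>i\<in>I. F i z) x = (\<Sum>i\<in>I. weinstein a (F i) x)"
  using assms(3) F
proof (induction I)
  case empty
  have "partial_deriv b (\<lambda>z. 0) x = 0" for b and x :: "real \<times> (real ^ 'a)"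
    by (simp add: partial_deriv_def)
  then have "partial_deriv b (\<lambda>z. 0) = (\<lambda>z. 0)" for b :: "real \<times> (real ^ 'a)"
    by (simp add: fun_eq_iff)
  then show ?case by (simp add: weinstein_Basis)
next
  case (insert i I)
  then show ?case
    using weinstein_add[OF assms(1,2) insert.prems[of i] twice_differentiable_on_sum[of S I F]]
      assms(1) by simp
qed

text \<open>The first-order part obeys the Leibniz rule, so only the second-order part leaves a
  gradient term. Applied to \<open>u\<close> this yields the carre du champ; applied to each first
  partial it yields the squared Hessian entries.\<close>

lemma weinstein_square:
  assumes "open S" "x \<in> S" and f: "twice_differentiable_on f S"
  shows "weinstein a (\<lambda>z. f z * f z) x
    = 2 * f x * weinstein a f x + 2 * (\<Sum>b\<in>Basis. (partial_deriv b f x)\<^sup>2)"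
  using twice_differentiable_onD[OF f assms(2)] partial_deriv2_square[OF assms(1) f assms(2)]
  by (simp add: weinstein_Basis partial_deriv_mult sum.distrib sum_distrib_left algebra_simps)

section \<open>The Bochner computation\<close>

lemma carre_du_champ_eq:
  assumes "open S" "x \<in> S" "twice_differentiable_on u S"
  shows "carre_du_champ a u u x = (\<Sum>b\<in>Basis. (partial_deriv b u x)\<^sup>2)"
  using weinstein_square[OF assms, of a] by (simp add: carre_du_champ_def)

text \<open>The last term comes from differentiating \<open>a / r\<close>; it is absent in the
  \<open>y\<close> directions and is the source of the commutator with the \<open>r\<close>
  derivative.\<close>

lemma partial_deriv_a_over_r:
  assumes "f differentiable at x" "fst x \<noteq> 0"
  shows "partial_deriv v (\<lambda>z. a / fst z * f z) x
    = a / fst x * partial_deriv v f x - a * fst v / (fst x)\<^sup>2 * f x"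
  by (rule partial_deriv_eq)
    (auto intro!: derivative_eq_intros has_derivative_partial_deriv assms
      simp: power2_eq_square assms field_simps)

text \<open>One order of regularity goes into the gradient inside \<open>P_fun\<close>, the other
  two into the operator applied to it.\<close>

lemma Cn_on_3D:
  assumes "open S" "Cn_on 3 S u"
  shows "twice_differentiable_on u S"
    and "b \<in> Basis \<Longrightarrow> twice_differentiable_on (partial_deriv b u) S"
    and "b \<in> Basis \<Longrightarrow> c \<in> Basis \<Longrightarrow> x \<in> S \<Longrightarrow>
      partial_deriv b (partial_deriv c u) x = partial_deriv c (partial_deriv b u) x"
proof -
  have u: "Cn_on (Suc (Suc (Suc 0))) S u"
    using assms by (simp add: numeral_3_eq_3)
  show 1: "twice_differentiable_on u S"
    using u by (rule twice_differentiable_on_Cn_on)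
  show "b \<in> Basis \<Longrightarrow> twice_differentiable_on (partial_deriv b u) S"
    using u by (auto simp: twice_differentiable_on_def)
  show "b \<in> Basis \<Longrightarrow> c \<in> Basis \<Longrightarrow> x \<in> S \<Longrightarrow>
      partial_deriv b (partial_deriv c u) x = partial_deriv c (partial_deriv b u) x"
    using twice_differentiable_onD[OF 1] by (intro partial_deriv_commute[OF assms(1)])
qed

text \<open>The operator commutes with \<open>\<partial>\<^sub>y\<close>, while \<open>[L\<^sub>a, \<partial>\<^sub>r] = a/r\<^sup>2 \<partial>\<^sub>r\<close>.\<close>

lemma weinstein_partial_deriv:
  fixes u :: "real \<times> (real ^ 'k) \<Rightarrow> real"
  assumes S: "open S" "S \<subseteq> half_space" and C: "Cn_on 3 S u"
    and L: "\<And>z. z \<in> S \<Longrightarrow> weinstein a u z = C0"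
    and x: "x \<in> S" and b: "b \<in> Basis"
  shows "weinstein a (partial_deriv b u) x = a * fst b / (fst x)\<^sup>2 * partial_deriv (1, 0) u x"
proof -
  note u = Cn_on_3D[OF S(1) C]
  note D = twice_differentiable_onD[OF u(1)] twice_differentiable_onD[OF u(2)]
  have r: "fst z \<noteq> 0" if "z \<in> S" for z
    using S that by (force simp: half_space_def)
  have er: "partial_deriv (1, 0) u differentiable at x"
    using D(2)[OF x e_r_in_Basis] .
  \<comment> \<open>Two exchanges: the outer one is symmetry for \<open>partial_deriv c u\<close>,
    the inner one symmetry for \<open>u\<close>, differentiated once more.\<close>
  have comm: "partial_deriv b (partial_deriv c (partial_deriv c u)) x
    = partial_deriv c (partial_deriv c (partial_deriv b u)) x" if c: "c \<in> Basis" for c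
  proof -
    have "partial_deriv b (partial_deriv c (partial_deriv c u)) x
      = partial_deriv c (partial_deriv b (partial_deriv c u)) x"
      using D x b c by (intro partial_deriv_commute[OF S(1)])
    also have "\<dots> = partial_deriv c (partial_deriv c (partial_deriv b u)) x"
      using u(3)[OF b c] by (intro partial_deriv_cong[OF S(1) x])
    finally show ?thesis .
  qed
  \<comment> \<open>The equation has a constant right-hand side, so its derivative in direction
    \<open>b\<close> is zero.\<close>
  have "0 = partial_deriv b (\<lambda>z. C0) x"
    by (simp add: partial_deriv_def)
  also have "\<dots> = partial_deriv b (\<lambda>z. (\<Sum>c\<in>Basis. partial_deriv c (partial_deriv c u) z)
      + a / fst z * partial_deriv (1, 0) u z) x"
    using L by (intro partial_deriv_cong[OF S(1) x]) (simp add: weinstein_Basis)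
  also have "\<dots> = partial_deriv b (\<lambda>z. \<Sum>c\<in>Basis. partial_deriv c (partial_deriv c u) z) x
      + partial_deriv b (\<lambda>z. a / fst z * partial_deriv (1, 0) u z) x"
  proof (rule partial_deriv_add)
    show "(\<lambda>z. \<Sum>c\<in>Basis. partial_deriv c (partial_deriv c u) z) differentiable at x"
      using D x by (intro differentiable_sum) auto
    have "fst differentiable at x"
      by (intro bounded_linear_imp_differentiable bounded_linear_fst)
    then show "(\<lambda>z. a / fst z * partial_deriv (1, 0) u z) differentiable at x"
      using er r[OF x] by (intro differentiable_mult differentiable_divide) auto
  qed
  also have "\<dots> = (\<Sum>c\<in>Basis. partial_deriv c (partial_deriv c (partial_deriv b u)) x)
     + (a / fst x * partial_deriv b (partial_deriv (1, 0) u) x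
        - a * fst b / (fst x)\<^sup>2 * partial_deriv (1, 0) u x)"
    unfolding partial_deriv_a_over_r[OF er r[OF x]]
    using D x comm by (simp add: partial_deriv_sum)
  finally show ?thesis
    using u(3)[OF b e_r_in_Basis x] by (simp add: weinstein_Basis)
qed

lemma sum_fst_Basis:
  fixes g :: "real \<times> (real ^ 'k) \<Rightarrow> real"
  shows "(\<Sum>b\<in>Basis. fst b * g b) = g (1, 0)"
proof -
  have "(\<Sum>b\<in>Basis. fst b * g b) = (\<Sum>b\<in>{(1, 0)}. fst b * g b)"
    by (rule sum.mono_neutral_right) (auto simp: Basis_half_space)
  then show ?thesis by simp
qed

text \<open>\<open>L\<^sub>a u = -1\<close> makes the cross terms of the squares add up to a constant.\<close>

lemma weinstein_P_fun:
  fixes u :: "real \<times> (real ^ 'k) \<Rightarrow> real"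
  assumes S: "open S" "S \<subseteq> half_space" and C: "Cn_on 3 S u"
    and L: "\<And>z. z \<in> S \<Longrightarrow> weinstein a u z = -1"
    and x: "x \<in> S" and N: "N = a + 1 + real CARD('k)" "N \<noteq> 0"
  shows "weinstein a (P_fun a u) x
    = 2 * ((\<Sum>b\<in>Basis. \<Sum>c\<in>Basis. (partial_deriv c (partial_deriv b u) x + b \<bullet> c / N)\<^sup>2)
           + a * (partial_deriv (1, 0) u x / fst x + 1 / N)\<^sup>2)"
proof -
  note u = Cn_on_3D[OF S(1) C]
  let ?D = "\<lambda>b. partial_deriv b u"
  let ?H = "\<lambda>b c. partial_deriv c (?D b) x"
  let ?r = "?D (1, 0) x / fst x"
  have sq: "twice_differentiable_on (\<lambda>z. ?D b z * ?D b z) S" if "b \<in> Basis" for b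
    using u(2)[OF that] by (intro twice_differentiable_on_mult S)
  have "weinstein a (P_fun a u) x
    = weinstein a (\<lambda>z. (\<Sum>b\<in>Basis. ?D b z * ?D b z) + 2 / N * u z) x"
    using carre_du_champ_eq[OF S(1) _ u(1)]
    by (intro weinstein_cong[OF S(1) x]) (simp add: P_fun_def N power2_eq_square)
  also have "\<dots> = (\<Sum>b\<in>Basis. weinstein a (\<lambda>z. ?D b z * ?D b z) x) + 2 / N * weinstein a u x"
    using S(1) x u(1) sq
    by (simp add: weinstein_add[of S] weinstein_sum[of S] weinstein_cmult[of S]
        twice_differentiable_on_sum twice_differentiable_on_cmult del: times_divide_eq_left)
  \<comment> \<open>The commutator carries the factor \<open>fst b\<close>, so its contribution to
    the sum collapses to the single direction \<open>(1, 0)\<close>.\<close>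
  also have "\<dots> = (\<Sum>b\<in>Basis. fst b * (2 * ?D b x * (a / (fst x)\<^sup>2 * ?D (1, 0) x))
      + 2 * (\<Sum>c\<in>Basis. (?H b c)\<^sup>2)) - 2 / N"
    using weinstein_square[OF S(1) x u(2), of _ a] weinstein_partial_deriv[OF S C L x] L[OF x]
    by (simp add: mult_ac)
  also have "\<dots> = 2 * ((\<Sum>b\<in>Basis. \<Sum>c\<in>Basis. (?H b c)\<^sup>2) + a * ?r\<^sup>2 - 1 / N)"
    unfolding sum.distrib sum_fst_Basis
    by (simp add: sum_distrib_left power2_eq_square algebra_simps)
  finally have eq: "weinstein a (P_fun a u) x
    = 2 * ((\<Sum>b\<in>Basis. \<Sum>c\<in>Basis. (?H b c)\<^sup>2) + a * ?r\<^sup>2 - 1 / N)" .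
  \<comment> \<open>By orthonormality only \<open>c = b\<close> contributes a cross term and a
    \<open>1 / N\<^sup>2\<close>.\<close>
  have row: "(\<Sum>c\<in>Basis. (?H b c + b \<bullet> c / N)\<^sup>2) = (\<Sum>c\<in>Basis. (?H b c)\<^sup>2) + 2 / N * ?H b b + 1 / N\<^sup>2"
    if b: "b \<in> Basis" for b
  proof -
    have "(\<Sum>c\<in>Basis. (?H b c + b \<bullet> c / N)\<^sup>2)
      = (\<Sum>c\<in>Basis. (?H b c)\<^sup>2 + (if b = c then 2 / N * ?H b b + 1 / N\<^sup>2 else 0))"
      using b by (intro sum.cong) (auto simp: inner_Basis power2_eq_square field_simps N(2))
    then show ?thesis
      using b by (simp add: sum.distrib)
  qed
  \<comment> \<open>The diagonal has 1 + k entries, which leaves exactly \<open>a\<close> to be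
    supplied by the weighted square.\<close>
  have dim: "1 + real CARD('k) = N - a"
    by (simp add: N(1))
  have "(\<Sum>b\<in>Basis. \<Sum>c\<in>Basis. (?H b c + b \<bullet> c / N)\<^sup>2)
    = (\<Sum>b\<in>Basis. \<Sum>c\<in>Basis. (?H b c)\<^sup>2) + 2 / N * (\<Sum>b\<in>Basis. ?H b b) + (N - a) / N\<^sup>2"
    using dim by (simp add: row sum.distrib sum_distrib_left)
  \<comment> \<open>Here \<open>- 1 - a * R\<close> is the trace of the Hessian, by the equation.
    The terms in \<open>R / N\<close> cancel, and the constants give
    \<open>- 2 / N + (N - a) / N\<^sup>2 + a / N\<^sup>2 = - 1 / N\<close>.\<close>
  moreover have alg: "A + a * R\<^sup>2 - 1 / N
    = A + 2 / N * (- 1 - a * R) + (N - a) / N\<^sup>2 + a * (R + 1 / N)\<^sup>2" for A R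
    using N(2) by (simp add: power2_eq_square field_simps)
  moreover have "(\<Sum>b\<in>Basis. ?H b b) = - 1 - a * ?r"
    using L[OF x] by (simp add: weinstein_Basis)
  ultimately show ?thesis
    unfolding eq alg by simp
qed

section \<open>Paraboloids and rigidity\<close>

lemma norm_half_space_point:
  "r\<^sup>2 + (norm (y - y0))\<^sup>2 = (norm ((r, y) - (0, y0)))\<^sup>2"
  by (simp add: norm_Pair)

text \<open>The centre \<open>p\<close> is arbitrary: the Hessian does not see it, and its
  \<open>r\<close> component is recovered later from the gradient.\<close>

lemma partial_derivs_paraboloid:
  fixes p :: "'a::euclidean_space"
  assumes S: "open S" and eq: "\<And>z. z \<in> S \<Longrightarrow> u z = \<gamma> - (norm (z - p))\<^sup>2 / (2 * N)"
    and N: "N \<noteq> 0" and x: "x \<in> S"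
  shows "partial_deriv b u x = (p - x) \<bullet> b / N"
    and "partial_deriv c (partial_deriv b u) x = - (b \<bullet> c / N)"
proof -
  have 1: "partial_deriv b u z = (p - z) \<bullet> b / N" if z: "z \<in> S" for z
  proof -
    have "partial_deriv b u z = partial_deriv b (\<lambda>z. \<gamma> - (z - p) \<bullet> (z - p) / (2 * N)) z"
      using eq by (intro partial_deriv_cong[OF S z]) (simp add: power2_norm_eq_inner)
    also have "\<dots> = (p - z) \<bullet> b / N"
      by (rule partial_deriv_eq)
        (auto intro!: derivative_eq_intros simp: N inner_commute inner_diff field_simps)
    finally show ?thesis .
  qed
  show "partial_deriv b u x = (p - x) \<bullet> b / N"
    by (rule 1[OF x])
  have "partial_deriv c (partial_deriv b u) x = partial_deriv c (\<lambda>z. (p - z) \<bullet> b / N) x"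
    using 1 by (intro partial_deriv_cong[OF S x])
  also have "\<dots> = - (b \<bullet> c / N)"
    by (rule partial_deriv_eq) (auto intro!: derivative_eq_intros simp: N inner_commute)
  finally show "partial_deriv c (partial_deriv b u) x = - (b \<bullet> c / N)" .
qed

text \<open>Two integrations on a connected set: first each \<open>partial_deriv b u\<close> plus a
  linear term is constant, then \<open>u\<close> plus a quadratic is constant.\<close>

lemma paraboloid_if_hessian_scalar:
  fixes u :: "'a::euclidean_space \<Rightarrow> real"
  assumes S: "open S" "connected S" and u: "twice_differentiable_on u S" and N: "N \<noteq> 0"
    and H: "\<And>z b c. z \<in> S \<Longrightarrow> b \<in> Basis \<Longrightarrow> c \<in> Basis \<Longrightarrow>
      partial_deriv c (partial_deriv b u) z = - (b \<bullet> c / N)"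
    and x: "x \<in> S"
  obtains p \<gamma> where "\<And>z. z \<in> S \<Longrightarrow> u z = \<gamma> - (norm (z - p))\<^sup>2 / (2 * N)"
proof -
  note D = twice_differentiable_onD[OF u]
  \<comment> \<open>Chosen so that the gradient of \<open>u\<close> at the base point
    \<open>x\<close> equals \<open>(p - x) / N\<close>.\<close>
  define p where "p = (\<Sum>b\<in>Basis. (N * partial_deriv b u x + x \<bullet> b) *\<^sub>R b)"
  have grad: "partial_deriv b u z = (p - z) \<bullet> b / N" if z: "z \<in> S" and b: "b \<in> Basis" for z b
  proof -
    let ?g = "\<lambda>z. partial_deriv b u z + z \<bullet> b / N"
    have g: "(?g has_derivative (\<lambda>v. partial_deriv v (partial_deriv b u) y + v \<bullet> b / N)) (at y)"
      if "y \<in> S" for y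
      using N by (auto intro!: derivative_eq_intros has_derivative_partial_deriv D that b)
    have "?g z = ?g x"
    proof (rule partial_derivs_zero_imp_constant[OF S _ _ z x])
      fix y assume y: "y \<in> S"
      show "?g differentiable at y"
        using g[OF y] by (auto simp: differentiable_def)
      fix c :: 'a assume c: "c \<in> Basis"
      show "partial_deriv c ?g y = 0"
        using partial_deriv_eq[OF g[OF y]] H[OF y b c] by (simp add: inner_commute)
    qed
    moreover have "p \<bullet> b = N * partial_deriv b u x + x \<bullet> b"
      using b by (simp add: p_def)
    ultimately show ?thesis
      using N by (simp add: inner_diff field_simps)
  qed
  let ?w = "\<lambda>z. u z + (z - p) \<bullet> (z - p) / (2 * N)"
  have w: "(?w has_derivative (\<lambda>v. partial_deriv v u y + v \<bullet> (y - p) / N)) (at y)" if "y \<in> S" for y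
    using N by (auto intro!: derivative_eq_intros has_derivative_partial_deriv D that
        simp: inner_commute field_simps)
  have "?w z = ?w x" if z: "z \<in> S" for z
  proof (rule partial_derivs_zero_imp_constant[OF S _ _ z x])
    fix y assume y: "y \<in> S"
    show "?w differentiable at y"
      using w[OF y] by (auto simp: differentiable_def)
    fix c :: 'a assume c: "c \<in> Basis"
    show "partial_deriv c ?w y = 0"
      unfolding partial_deriv_eq[OF w[OF y]] grad[OF y c] using N
      by (simp add: inner_commute inner_diff field_simps)
  qed
  then have "u z = ?w x - (norm (z - p))\<^sup>2 / (2 * N)" if "z \<in> S" for z
    using that by (simp add: power2_norm_eq_inner eq_diff_eq)
  then show thesis
    by (rule that)
qed

text \<open>For \<open>a = 0\<close> paraboloids with any centre \<open>p\<close> give equality, and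
  on a disconnected set the centre and \<open>\<gamma>\<close> may differ between components. Hence
  the equivalence is stated for \<open>a > 0\<close> and connected \<open>\<Omega>\<close>, the
  other two claims for all \<open>a \<ge> 0\<close>.\<close>

theorem theorem2p5:
  fixes a :: real and \<Omega> :: "(real \<times> (real ^ 'k)) set" and u :: "real \<times> (real ^ 'k) \<Rightarrow> real"
  assumes "a \<ge> 0"
    and "open \<Omega>" and "\<Omega> \<subseteq> half_space"
    and "Cn_on 3 \<Omega> u"
    and "\<forall>x\<in>\<Omega>. weinstein a u x = -1"
  shows "(\<forall>x\<in>\<Omega>. weinstein a (P_fun a u) x \<ge> 0)
    \<and> ((\<exists>y0 \<gamma>. \<forall>(r, y)\<in>\<Omega>.
            u (r, y) = \<gamma> - (r\<^sup>2 + (norm (y - y0))\<^sup>2) / (2 * (a + 1 + real CARD('k))))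
          \<longrightarrow> (\<forall>x\<in>\<Omega>. weinstein a (P_fun a u) x = 0))
    \<and> (a > 0 \<and> connected \<Omega> \<longrightarrow>
          ((\<forall>x\<in>\<Omega>. weinstein a (P_fun a u) x = 0) \<longleftrightarrow>
           (\<exists>y0 \<gamma>. \<forall>(r, y)\<in>\<Omega>.
              u (r, y) = \<gamma> - (r\<^sup>2 + (norm (y - y0))\<^sup>2) / (2 * (a + 1 + real CARD('k))))))"
proof -
  let ?N = "a + 1 + real CARD('k)"
  let ?sol = "\<exists>y0 \<gamma>. \<forall>(r, y)\<in>\<Omega>. u (r, y) = \<gamma> - (r\<^sup>2 + (norm (y - y0))\<^sup>2) / (2 * ?N)"
  let ?eq = "\<forall>x\<in>\<Omega>. weinstein a (P_fun a u) x = 0"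
  have N: "?N > 0"
    using assms(1) by simp
  have L: "\<And>z. z \<in> \<Omega> \<Longrightarrow> weinstein a u z = -1"
    using assms(5) by blast
  have r: "fst z > 0" if "z \<in> \<Omega>" for z
    using assms(3) that by (force simp: half_space_def)
  have W: "weinstein a (P_fun a u) x
    = 2 * ((\<Sum>b\<in>Basis. \<Sum>c\<in>Basis. (partial_deriv c (partial_deriv b u) x + b \<bullet> c / ?N)\<^sup>2)
           + a * (partial_deriv (1, 0) u x / fst x + 1 / ?N)\<^sup>2)" if "x \<in> \<Omega>" for x
    using N by (intro weinstein_P_fun[OF assms(2-4) L that refl]) simp_all
  have nonneg: "\<forall>x\<in>\<Omega>. weinstein a (P_fun a u) x \<ge> 0"
    using assms(1) by (auto simp: W intro!: add_nonneg_nonneg sum_nonneg)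
  have sol_eq: ?eq if sol: ?sol
  proof
    fix x assume x: "x \<in> \<Omega>"
    obtain y0 \<gamma> where "\<forall>(r, y)\<in>\<Omega>. u (r, y) = \<gamma> - (r\<^sup>2 + (norm (y - y0))\<^sup>2) / (2 * ?N)"
      using sol by blast
    then have u: "u z = \<gamma> - (norm (z - (0, y0)))\<^sup>2 / (2 * ?N)" if "z \<in> \<Omega>" for z
      using that by (cases z) (auto simp only: norm_half_space_point[symmetric])
    have N0: "?N \<noteq> 0"
      using N by simp
    have "partial_deriv c (partial_deriv b u) x + b \<bullet> c / ?N = 0" for b c
      by (subst partial_derivs_paraboloid(2)[OF assms(2) u N0 x]) simp_all
    \<comment> \<open>The centre \<open>(0, y0)\<close> has no \<open>r\<close> component, so the
      \<open>r\<close> derivative is \<open>- r / ?N\<close>.\<close>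
    moreover have "partial_deriv (1, 0) u x / fst x + 1 / ?N = 0"
      by (subst partial_derivs_paraboloid(1)[OF assms(2) u N0 x])
        (use r[OF x] N0 in \<open>simp_all add: inner_prod_def\<close>)
    ultimately show "weinstein a (P_fun a u) x = 0"
      by (simp add: W[OF x])
  qed
  have eq_sol: ?sol if a: "a > 0" and conn: "connected \<Omega>" and ?eq
  proof (cases "\<Omega> = {}")
    case False
    then obtain x where x: "x \<in> \<Omega>" by blast
    \<comment> \<open>A vanishing sum of nonnegative terms vanishes termwise; \<open>a > 0\<close>
      is what frees the last square from its weight.\<close>
    have zero: "(\<forall>b\<in>Basis. \<forall>c\<in>Basis. partial_deriv c (partial_deriv b u) z + b \<bullet> c / ?N = 0)
      \<and> partial_deriv (1, 0) u z / fst z + 1 / ?N = 0" if z: "z \<in> \<Omega>" for z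
    proof -
      let ?S = "\<Sum>b\<in>Basis. \<Sum>c\<in>Basis. (partial_deriv c (partial_deriv b u) z + b \<bullet> c / ?N)\<^sup>2"
      let ?R = "a * (partial_deriv (1, 0) u z / fst z + 1 / ?N)\<^sup>2"
      have "?S + ?R = 0"
        using W[OF z] \<open>?eq\<close> z by auto
      moreover have "?S \<ge> 0" "?R \<ge> 0"
        using a by (auto intro!: sum_nonneg)
      ultimately have "?S = 0" "?R = 0"
        by linarith+
      then show ?thesis
        using a by (simp add: sum_nonneg_eq_0_iff sum_nonneg)
    qed
    obtain p \<gamma> where p: "\<And>z. z \<in> \<Omega> \<Longrightarrow> u z = \<gamma> - (norm (z - p))\<^sup>2 / (2 * ?N)"
    proof (rule paraboloid_if_hessian_scalar[OF assms(2) conn Cn_on_3D(1)[OF assms(2,4)] _ _ x])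
      show "?N \<noteq> 0" using N by simp
      show "partial_deriv c (partial_deriv b u) z = - (b \<bullet> c / ?N)"
        if "z \<in> \<Omega>" "b \<in> Basis" "c \<in> Basis" for z b c
        using zero[OF that(1)] that(2,3) by (auto simp: eq_neg_iff_add_eq_0)
    qed blast
    have "partial_deriv (1, 0) u x = (fst p - fst x) / ?N"
      using partial_derivs_paraboloid(1)[OF assms(2) p less_imp_neq[OF N, symmetric] x, of "(1, 0)"] by (simp add: inner_prod_def)
    \<comment> \<open>With \<open>P = fst p\<close> and \<open>R = r\<close>, the weighted square is
      that of \<open>fst p / (?N * r)\<close>, so its vanishing forces the centre onto the boundary
      \<open>r = 0\<close>.\<close>
    moreover have "(P - R) / M / R + 1 / M = P / (M * R)" if "M > 0" "R > 0" for P R M :: real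
      using that by (simp add: field_simps)
    ultimately have "fst p / (?N * fst x) = 0"
      using zero[OF x] r[OF x] N by metis
    then have "fst p = 0"
      using r[OF x] N by simp
    then have "p = (0, snd p)"
      by (cases p) simp
    then have "u (s, y) = \<gamma> - (s\<^sup>2 + (norm (y - snd p))\<^sup>2) / (2 * ?N)" if "(s, y) \<in> \<Omega>" for s y
      unfolding norm_half_space_point using p[OF that] by metis
    then show ?sol
      by blast
  qed simp
  show ?thesis
    using nonneg sol_eq eq_sol by blast
qed

end
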